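(* Suppose that $\mathrm{diam}(\Omega)<\infty$ and that there is $d_0>0$ such that $d(x,y)\ge d_0$ for any $x\neq y$ in $\Omega$. Then for every $\epsilon>0$, $$t_{\mathrm{mix}}(\epsilon)\le\inf\{k: k\in\mathbb{N},\ 1-\kappa_k\le\epsilon\, d_0/\mathrm{diam}(\Omega)\}.$$ Conversely, for any $\epsilon>0$ and any integer $k\ge t_{\mathrm{mix}}(\epsilon/2)$, $$\kappa_k\ge 1-\epsilon\cdot\mathrm{diam}(\Omega)/d_0 .$$
   Context: $(\Omega,d)$ is a Polish metric space (with at least two points, so $\mathrm{diam}(\Omega)>0$) and $P(x,\mathrm{d}y)$ is a Markov kernel on $\Omega$, measurable in $x$, with stationary distribution $\pi$; $P_x=P(x,\cdot)$. $P^k_x$ is the $k$-step kernel, $P^0_x=\delta_x$; $\mathbb{N}$ contains $0$. $W_1(\mu_1,\mu_2)=\inf\mathbb{E}(d(X,Y))$ over all couplings $(X,Y)$ of $\mu_1,\mu_2$. Multi-step coarse Ricci curvature: $\kappa_k(x,y)=1-W_1(P^k_x,P^k_y)/d(x,y)$ for $x\ne y$, $\kappa_k(x,x)=1$, $\kappa_k=\inf_{x,y\in\Omega}\kappa_k(x,y)$. Mixing time: with $d_{\mathrm{TV}}(\mu,\nu)=\sup_A|\mu(A)-\nu(A)|$ the total variation distance, $t_{\mathrm{mix}}(\epsilon)=\min\{t\in\mathbb{N}:\sup_{x\in\Omega}d_{\mathrm{TV}}(P^t_x,\pi)\le\epsilon\}$ ($+\infty$ if there is no such $t$; likewise the infimum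 of the empty set is $+\infty$). *)

theory Defs
  imports "HOL-Probability.Probability"
begin

text \<open>
  The metric space \<open>\<Omega>\<close> is a type of class \<open>polish_space\<close> (complete and second countable, i.e.
  complete and separable) with its metric \<^const>\<open>dist\<close>; its sigma-algebra is \<^const>\<open>borel\<close>.
\<close>

text \<open>
  Measurability into \<^const>\<open>prob_algebra\<close> says that every \<open>P x\<close> is a Borel probability measure and
  that \<open>x \<mapsto> P x A\<close> is measurable for every Borel set \<open>A\<close>.
\<close>

definition markov_kernel :: "('a::polish_space \<Rightarrow> 'a measure) \<Rightarrow> bool" where
  "markov_kernel P \<longleftrightarrow> P \<in> borel \<rightarrow>\<^sub>M prob_algebra borel"

definition stationary_distribution ::
    "('a::polish_space \<Rightarrow> 'a measure) \<Rightarrow> 'a measure \<Rightarrow> bool" where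
  "stationary_distribution P \<pi> \<longleftrightarrow> \<pi> \<in> space (prob_algebra borel) \<and> \<pi> \<bind> P = \<pi>"

primrec kernel_step :: "('a::polish_space \<Rightarrow> 'a measure) \<Rightarrow> nat \<Rightarrow> 'a \<Rightarrow> 'a measure" where
  "kernel_step P 0 x = return borel x"
| "kernel_step P (Suc k) x = kernel_step P k x \<bind> P"

text \<open>
  A coupling \<open>(X, Y)\<close> is represented by its joint law. Expected distances, and hence \<open>W\<^sub>1\<close>, are
  allowed to be infinite; curvatures are therefore extended reals.
\<close>

definition couplings :: "'a::polish_space measure \<Rightarrow> 'a measure \<Rightarrow> ('a \<times> 'a) measure set" where
  "couplings \<mu> \<nu> = {\<gamma> \<in> space (prob_algebra (borel \<Otimes>\<^sub>M borel)).
     distr \<gamma> borel fst = \<mu> \<and> distr \<gamma> borel snd = \<nu>}"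

definition wasserstein1 :: "'a::polish_space measure \<Rightarrow> 'a measure \<Rightarrow> ennreal" where
  "wasserstein1 \<mu> \<nu> = (INF \<gamma>\<in>couplings \<mu> \<nu>. \<integral>\<^sup>+(x, y). ennreal (dist x y) \<partial>\<gamma>)"

definition curvature_at ::
    "('a::polish_space \<Rightarrow> 'a measure) \<Rightarrow> nat \<Rightarrow> 'a \<Rightarrow> 'a \<Rightarrow> ereal" where
  "curvature_at P k x y =
     (if x = y then 1
      else 1 - enn2ereal (wasserstein1 (kernel_step P k x) (kernel_step P k y)) / ereal (dist x y))"

definition curvature :: "('a::polish_space \<Rightarrow> 'a measure) \<Rightarrow> nat \<Rightarrow> ereal" where
  "curvature P k = (INF (x, y)\<in>UNIV. curvature_at P k x y)"

text \<open>
  Extended reals and extended naturals are used so that \<open>Sup\<close> and \<open>Inf\<close> are those of a complete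
  lattice; in particular, the infimum of the empty set is \<open>\<infinity>\<close>. A nonempty set in \<^typ>\<open>enat\<close>
  contains its infimum, so \<open>mixing_time\<close> is a minimum whenever it is finite.
\<close>

definition tv_dist :: "'a::polish_space measure \<Rightarrow> 'a measure \<Rightarrow> ereal" where
  "tv_dist \<mu> \<nu> = (SUP A\<in>sets borel. ereal \<bar>measure \<mu> A - measure \<nu> A\<bar>)"

definition mixing_time ::
    "('a::polish_space \<Rightarrow> 'a measure) \<Rightarrow> 'a measure \<Rightarrow> real \<Rightarrow> enat" where
  "mixing_time P \<pi> \<epsilon> = Inf {enat t | t. (SUP x. tv_dist (kernel_step P t x) \<pi>) \<le> ereal \<epsilon>}"

end

theory Submission
  imports Defs
begin

text \<open>
  On a space with all distances in \<open>[d0, D]\<close>, the inequalities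
  \<open>d0 * 1(x \<noteq> y) \<le> dist x y \<le> D * 1(x \<noteq> y)\<close> compare \<open>W1\<close> with total variation: every coupling
  bounds total variation by \<open>W1 / d0\<close>, and a maximal coupling gives \<open>W1 \<le> D * TV\<close>. Averaging over
  the starting point passes between \<open>TV(P\<^sup>k x, P\<^sup>k y)\<close> and \<open>TV(P\<^sup>k x, \<pi>)\<close>, and also shows that a
  bound on the distance to \<open>\<pi>\<close> uniform in the starting point persists at later times.
\<close>

section \<open>Averaging bounds against a kernel\<close>

lemma tv_dist_le_iff:
  "tv_dist \<mu> \<nu> \<le> ereal e \<longleftrightarrow> (\<forall>A\<in>sets borel. \<bar>measure \<mu> A - measure \<nu> A\<bar> \<le> e)"
  by (simp add: tv_dist_def SUP_le_iff)

lemma sets_prob_algebraD: "\<mu> \<in> space (prob_algebra M) \<Longrightarrow> sets \<mu> = sets M"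
  by (simp add: space_prob_algebra)

lemma prob_space_prob_algebraD: "\<mu> \<in> space (prob_algebra M) \<Longrightarrow> prob_space \<mu>"
  by (simp add: space_prob_algebra)

text \<open>The measure of \<open>A\<close> under \<open>\<rho> \<bind> K\<close> is the
  \<open>\<rho>\<close>-average of \<open>measure (K y) A\<close>, and an average of numbers in the
  interval from \<open>c - e\<close> to \<open>c + e\<close> stays in it. Every averaging over
  starting points below is an instance.\<close>

lemma measure_bind_dist_le:
  assumes \<rho>: "\<rho> \<in> space (prob_algebra M)"
    and K: "K \<in> M \<rightarrow>\<^sub>M prob_algebra N" and A: "A \<in> sets N"
    and bound: "\<And>y. y \<in> space M \<Longrightarrow> \<bar>measure (K y) A - c\<bar> \<le> e"
  shows "\<bar>measure (\<rho> \<bind> K) A - c\<bar> \<le> e"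
proof -
  interpret prob_space \<rho> using \<rho> by (rule prob_space_prob_algebraD)
  have sets: "sets \<rho> = sets M" using \<rho> by (rule sets_prob_algebraD)
  have sp: "space \<rho> = space M" using sets by (rule sets_eq_imp_space_eq)
  have K': "K \<in> \<rho> \<rightarrow>\<^sub>M subprob_algebra N"
    using K sets by (metis measurable_cong_sets measurable_prob_algebraD)
  have meas: "(\<lambda>y. measure (K y) A) \<in> borel_measurable \<rho>"
    using measurable_compose[OF K' measurable_measure_subprob_algebra[OF A]] by simp
  have int: "integrable \<rho> (\<lambda>y. measure (K y) A)"
  proof (rule integrable_const_bound[where B = "\<bar>c\<bar> + e"])
    show "AE y in \<rho>. norm (measure (K y) A) \<le> \<bar>c\<bar> + e"
      using bound sp by (intro AE_I2) fastforce
  qed (rule meas)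
  have "measure (\<rho> \<bind> K) A = (\<integral>y. measure (K y) A \<partial>\<rho>)"
    using K' A by (rule measure_bind)
  moreover have "(\<integral>y. measure (K y) A \<partial>\<rho>) \<le> c + e"
    using bound sp by (intro integral_le_const[OF int] AE_I2) fastforce
  moreover have "(\<integral>y. measure (K y) A \<partial>\<rho>) \<ge> c - e"
    using bound sp by (intro integral_ge_const[OF int] AE_I2) fastforce
  ultimately show ?thesis by linarith
qed

section \<open>Iterates of the kernel\<close>

lemma measurable_kernel_step:
  assumes "markov_kernel P"
  shows "kernel_step P k \<in> borel \<rightarrow>\<^sub>M prob_algebra borel"
proof (induction k)
  case 0
  have "kernel_step P 0 = return borel" by (rule ext) simp
  then show ?case by (simp add: measurable_return_prob_space)
next
  case (Suc k)
  have "kernel_step P (Suc k) = (\<lambda>x. kernel_step P k x \<bind> P)" by (rule ext) simp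
  then show ?case
    using measurable_bind_prob_space[OF Suc] assms by (simp add: markov_kernel_def)
qed

lemma kernel_step_in_prob_algebra:
  "markov_kernel P \<Longrightarrow> kernel_step P k x \<in> space (prob_algebra borel)"
  using measurable_space[OF measurable_kernel_step] by simp

lemma kernel_bind_assoc:
  assumes "\<mu> \<in> space (prob_algebra borel)" "markov_kernel P"
  shows "\<mu> \<bind> kernel_step P k \<bind> P = \<mu> \<bind> kernel_step P (Suc k)"
proof -
  have "kernel_step P k \<in> \<mu> \<rightarrow>\<^sub>M subprob_algebra borel"
    using measurable_prob_algebraD[OF measurable_kernel_step[OF assms(2)]]
      sets_prob_algebraD[OF assms(1)] by (metis measurable_cong_sets)
  moreover have "P \<in> borel \<rightarrow>\<^sub>M subprob_algebra borel"
    using assms(2) by (auto simp: markov_kernel_def intro: measurable_prob_algebraD)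
  moreover have "kernel_step P (Suc k) = (\<lambda>x. kernel_step P k x \<bind> P)" by (rule ext) simp
  ultimately show ?thesis by (simp add: bind_assoc)
qed

lemma bind_kernel_step_0:
  assumes "\<mu> \<in> space (prob_algebra borel)"
  shows "\<mu> \<bind> kernel_step P 0 = \<mu>"
proof -
  \<comment> \<open>\<open>return\<close> depends only on the sigma-algebra of its first argument,
    so replacing \<open>borel\<close> by \<open>\<mu>\<close> changes nothing and gives the form of
    the right unit law.\<close>
  have "kernel_step P 0 = return \<mu>"
    using return_sets_cong[OF sets_prob_algebraD[OF assms]] by (intro ext) simp
  then show ?thesis by (simp add: bind_return')
qed

text \<open>The Chapman-Kolmogorov equation. The induction runs on the later block \<open>t\<close>
  because \<open>kernel_step\<close> appends new steps at the end.\<close>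

lemma kernel_step_add:
  assumes "markov_kernel P"
  shows "kernel_step P (s + t) x = kernel_step P s x \<bind> kernel_step P t"
proof (induction t)
  case 0
  show ?case by (simp only: bind_kernel_step_0[OF kernel_step_in_prob_algebra[OF assms]] add_0_right)
next
  case (Suc t)
  then show ?case
    using kernel_bind_assoc[OF kernel_step_in_prob_algebra[OF assms] assms]
    by (simp del: kernel_step.simps(2) add: kernel_step.simps(2)[of P "s + t"])
qed

lemma stationary_kernel_step:
  assumes "markov_kernel P" "stationary_distribution P \<pi>"
  shows "\<pi> \<bind> kernel_step P t = \<pi>"
proof (induction t)
  case 0
  show ?case using assms by (intro bind_kernel_step_0) (simp add: stationary_distribution_def)
next
  case (Suc t)
  then show ?case
    using kernel_bind_assoc[of \<pi> P t] assms
    by (simp del: kernel_step.simps add: stationary_distribution_def)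
qed

section \<open>Distance to stationarity and the mixing time\<close>

text \<open>By stationarity \<open>\<pi>\<close> is the average of \<open>kernel_step P k y\<close>
  over \<open>y\<close> drawn from \<open>\<pi>\<close>, so the bound for fixed \<open>x\<close> and
  all \<open>y\<close> survives with the same \<open>e\<close>.\<close>

lemma tv_dist_stationary_le:
  assumes P: "markov_kernel P" and \<pi>: "stationary_distribution P \<pi>"
    and bound: "\<And>y. tv_dist (kernel_step P k x) (kernel_step P k y) \<le> ereal e"
  shows "tv_dist (kernel_step P k x) \<pi> \<le> ereal e"
  unfolding tv_dist_le_iff
proof
  fix A :: "'a set" assume A: "A \<in> sets borel"
  have "\<bar>measure (\<pi> \<bind> kernel_step P k) A - measure (kernel_step P k x) A\<bar> \<le> e"
  proof (rule measure_bind_dist_le[OF _ measurable_kernel_step[OF P] A])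
    show "\<pi> \<in> space (prob_algebra borel)" using \<pi> by (simp add: stationary_distribution_def)
    fix y
    show "\<bar>measure (kernel_step P k y) A - measure (kernel_step P k x) A\<bar> \<le> e"
      using bound[of y] A unfolding tv_dist_le_iff by (simp add: abs_minus_commute)
  qed
  then show "\<bar>measure (kernel_step P k x) A - measure \<pi> A\<bar> \<le> e"
    by (simp add: stationary_kernel_step[OF P \<pi>] abs_minus_commute)
qed

text \<open>The first \<open>k - t\<close> steps only randomise the starting point of the last
  \<open>t\<close> steps, and the bound is uniform in that point.\<close>

lemma tv_dist_stationary_mono:
  assumes P: "markov_kernel P"
    and bound: "\<And>y. tv_dist (kernel_step P t y) \<pi> \<le> ereal e" and "t \<le> k"
  shows "tv_dist (kernel_step P k x) \<pi> \<le> ereal e"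
  unfolding tv_dist_le_iff
proof
  fix A :: "'a set" assume A: "A \<in> sets borel"
  have "\<bar>measure (kernel_step P (k - t) x \<bind> kernel_step P t) A - measure \<pi> A\<bar> \<le> e"
    using bound A unfolding tv_dist_le_iff
    by (intro measure_bind_dist_le[OF kernel_step_in_prob_algebra[OF P] measurable_kernel_step[OF P] A])
      auto
  then show "\<bar>measure (kernel_step P k x) A - measure \<pi> A\<bar> \<le> e"
    using kernel_step_add[OF P, of "k - t" t x] \<open>t \<le> k\<close> by simp
qed

text \<open>The mixing time is the first good time; since good times persist, all times from it on
  are good.\<close>

lemma mixing_time_le_iff:
  assumes P: "markov_kernel P"
  shows "mixing_time P \<pi> e \<le> enat k \<longleftrightarrow> (\<forall>x. tv_dist (kernel_step P k x) \<pi> \<le> ereal e)"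
proof
  let ?S = "{enat t | t. (SUP x. tv_dist (kernel_step P t x) \<pi>) \<le> ereal e}"
  assume le: "mixing_time P \<pi> e \<le> enat k"
  \<comment> \<open>The infimum of the empty set would be \<open>\<infinity>\<close>; for a nonempty
    set it is a least element and hence attained.\<close>
  then have "?S \<noteq> {}"
    unfolding mixing_time_def using Inf_enat_def[of ?S] by (metis enat_ord_code(5))
  then have "mixing_time P \<pi> e \<in> ?S"
    unfolding mixing_time_def Inf_enat_def by (auto intro: LeastI)
  then obtain t where "mixing_time P \<pi> e = enat t" "\<And>y. tv_dist (kernel_step P t y) \<pi> \<le> ereal e"
    by (auto simp: SUP_le_iff)
  then show "\<forall>x. tv_dist (kernel_step P k x) \<pi> \<le> ereal e"
    using le by (auto intro: tv_dist_stationary_mono[OF P, of t])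
next
  assume "\<forall>x. tv_dist (kernel_step P k x) \<pi> \<le> ereal e"
  then show "mixing_time P \<pi> e \<le> enat k"
    unfolding mixing_time_def by (intro Inf_lower) (auto simp: SUP_le_iff)
qed

section \<open>Total variation bounded by the Wasserstein distance\<close>

text \<open>If the first coordinate lies in \<open>A\<close> and the second does not, the two points
  differ and are at least \<open>d0\<close> apart. This event has probability at least
  \<open>measure \<mu> A - measure \<nu> A\<close>.\<close>

lemma coupling_measure_diff_le:
  fixes \<mu> \<nu> :: "'a::polish_space measure"
  assumes \<gamma>: "\<gamma> \<in> couplings \<mu> \<nu>" and A: "A \<in> sets borel"
    and "d0 \<ge> 0" and sep: "\<And>x y :: 'a. x \<noteq> y \<Longrightarrow> dist x y \<ge> d0"
  shows "ennreal (d0 * (measure \<mu> A - measure \<nu> A)) \<le> (\<integral>\<^sup>+(x, y). ennreal (dist x y) \<partial>\<gamma>)"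
proof -
  have "prob_space \<gamma>" and sets: "sets \<gamma> = sets (borel \<Otimes>\<^sub>M borel)"
    using \<gamma> by (auto simp: couplings_def space_prob_algebra)
  then interpret prob_space \<gamma> by simp
  have sp: "space \<gamma> = UNIV" using sets_eq_imp_space_eq[OF sets] by (simp add: space_pair_measure)
  have fst: "fst \<in> \<gamma> \<rightarrow>\<^sub>M borel" and snd: "snd \<in> \<gamma> \<rightarrow>\<^sub>M borel"
    by (simp_all add: measurable_cong_sets[OF sets refl])
  have "measure \<mu> A = measure \<gamma> (A \<times> UNIV)"
    using \<gamma> A measure_distr[OF fst A] by (auto simp: couplings_def sp fst_vimage_eq_Times)
  moreover have "measure \<nu> A = measure \<gamma> (UNIV \<times> A)"
    using \<gamma> A measure_distr[OF snd A] by (auto simp: couplings_def sp snd_vimage_eq_Times)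
  \<comment> \<open>\<open>A \<times> UNIV\<close> is split according to whether the second
    coordinate is in \<open>A\<close>.\<close>
  moreover have "measure \<gamma> (A \<times> UNIV) \<le> measure \<gamma> (UNIV \<times> A \<union> A \<times> (- A))"
    using A by (intro finite_measure_mono) (auto simp: sets intro!: pair_measureI borel_comp)
  moreover have "\<dots> \<le> measure \<gamma> (UNIV \<times> A) + measure \<gamma> (A \<times> (- A))"
    using A by (intro measure_Un_le) (auto simp: sets intro!: pair_measureI borel_comp)
  ultimately have "d0 * (measure \<mu> A - measure \<nu> A) \<le> d0 * measure \<gamma> (A \<times> (- A))"
    using \<open>d0 \<ge> 0\<close> by (intro mult_left_mono) auto
  then have "ennreal (d0 * (measure \<mu> A - measure \<nu> A)) \<le> ennreal d0 * emeasure \<gamma> (A \<times> (- A))"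
    using \<open>d0 \<ge> 0\<close> by (simp add: emeasure_eq_measure ennreal_mult[symmetric] ennreal_leI)
  also have "\<dots> = (\<integral>\<^sup>+z. ennreal d0 * indicator (A \<times> (- A)) z \<partial>\<gamma>)"
    using A by (intro nn_integral_cmult_indicator[symmetric])
      (auto simp: sets intro!: pair_measureI borel_comp)
  also have "\<dots> \<le> (\<integral>\<^sup>+(x, y). ennreal (dist x y) \<partial>\<gamma>)"
    by (intro nn_integral_mono) (auto simp: indicator_def intro!: ennreal_leI sep)
  finally show ?thesis .
qed

text \<open>The bound for a single coupling passes to the infimum. It controls only one sign of the
  difference; the other sign comes from the complement of \<open>A\<close>.\<close>

lemma tv_dist_le_wasserstein1:
  fixes \<mu> \<nu> :: "'a::polish_space measure"
  assumes \<mu>: "\<mu> \<in> space (prob_algebra borel)" and \<nu>: "\<nu> \<in> space (prob_algebra borel)"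
    and d0: "d0 > 0" and sep: "\<And>x y :: 'a. x \<noteq> y \<Longrightarrow> dist x y \<ge> d0"
    and W: "wasserstein1 \<mu> \<nu> \<le> ennreal (e * d0)" and "e \<ge> 0"
  shows "tv_dist \<mu> \<nu> \<le> ereal e"
  unfolding tv_dist_le_iff
proof
  have le: "measure \<mu> A - measure \<nu> A \<le> e" if "A \<in> sets borel" for A
  proof -
    have "ennreal (d0 * (measure \<mu> A - measure \<nu> A)) \<le> wasserstein1 \<mu> \<nu>"
      unfolding wasserstein1_def using that d0 sep
      by (intro INF_greatest coupling_measure_diff_le) auto
    also note W
    finally have "d0 * (measure \<mu> A - measure \<nu> A) \<le> d0 * e"
      using d0 \<open>e \<ge> 0\<close> by (subst (asm) ennreal_le_iff) (auto simp: mult.commute)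
    then show ?thesis using d0 by simp
  qed
  fix A :: "'a set" assume A: "A \<in> sets borel"
  interpret \<mu>: prob_space \<mu> using \<mu> by (rule prob_space_prob_algebraD)
  interpret \<nu>: prob_space \<nu> using \<nu> by (rule prob_space_prob_algebraD)
  have sets: "sets \<mu> = sets borel" "sets \<nu> = sets borel"
    using \<mu> \<nu> by (auto dest: sets_prob_algebraD)
  then have "space \<mu> = UNIV" "space \<nu> = UNIV" by (auto dest: sets_eq_imp_space_eq)
  then have "measure \<mu> (- A) - measure \<nu> (- A) = measure \<nu> A - measure \<mu> A"
    using \<mu>.prob_compl[of A] \<nu>.prob_compl[of A] A sets by (simp add: Compl_eq_Diff_UNIV)
  with le[of A] le[of "- A"] A show "\<bar>measure \<mu> A - measure \<nu> A\<bar> \<le> e"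
    by (simp add: borel_comp abs_le_iff)
qed

section \<open>The Wasserstein distance bounded by total variation\<close>

text \<open>Balls of radius \<open>d0\<close> are singletons, so the singletons are disjoint open
  sets, of which a second countable space has only countably many. Measures are then determined by
  point masses, as the maximal coupling requires.\<close>

lemma countable_separated_UNIV:
  fixes d0 :: real
  assumes "d0 > 0" and sep: "\<And>x y :: 'a::{metric_space,second_countable_topology}. x \<noteq> y \<Longrightarrow> dist x y \<ge> d0"
  shows "countable (UNIV :: 'a set)"
proof -
  have "{x} = ball x d0" for x :: 'a
    using \<open>d0 > 0\<close> sep[of x] by (auto simp: set_eq_iff) (metis leD)
  then have "open {x}" for x :: 'a by (metis open_ball)
  then have "countable (range (\<lambda>x::'a. {x}))"
    by (intro countable_disjoint_open_subsets) (auto simp: pairwise_def)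
  then show ?thesis by (rule countable_image_inj_on) (auto simp: inj_on_def)
qed

text \<open>
  The maximal coupling puts the common mass \<open>min \<mu> \<nu>\<close> on the diagonal and couples the excesses
  \<open>\<mu> - \<nu>\<close> and \<open>\<nu> - \<mu>\<close> (truncated subtraction) independently; both have total mass \<open>\<delta>\<close>.
\<close>

lemma wasserstein1_le_of_countable:
  fixes \<mu> \<nu> :: "'a::polish_space measure"
  assumes countable: "countable (UNIV :: 'a set)"
    and \<mu>: "\<mu> \<in> space (prob_algebra borel)" and \<nu>: "\<nu> \<in> space (prob_algebra borel)"
    and diam: "\<And>x y :: 'a. dist x y \<le> D" and tv: "tv_dist \<mu> \<nu> \<le> ereal e"
  shows "wasserstein1 \<mu> \<nu> \<le> ennreal (D * e)"
proof -
  interpret \<mu>: prob_space \<mu> using \<mu> by (rule prob_space_prob_algebraD)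
  interpret \<nu>: prob_space \<nu> using \<nu> by (rule prob_space_prob_algebraD)
  have borel: "sets (borel :: 'a measure) = UNIV"
    using sets_eq_countable[OF countable, of borel] by simp
  then have sets: "sets \<mu> = UNIV" "sets \<nu> = UNIV"
    using \<mu> \<nu> by (auto dest: sets_prob_algebraD)
  then have sp: "space \<mu> = UNIV" "space \<nu> = UNIV"
    by (auto simp: sets_eq_imp_space_eq[of _ borel] borel)
  \<comment> \<open>With the product sigma-algebra discrete too, the coupling can be given as a
    density over \<open>count_space\<close>.\<close>
  have pair: "sets (borel \<Otimes>\<^sub>M borel :: ('a \<times> 'a) measure) = UNIV"
  proof -
    have "{z} \<in> sets (borel \<Otimes>\<^sub>M borel)" for z :: "'a \<times> 'a"
      using pair_measureI[of "{fst z}" borel "{snd z}" borel] by simp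
    moreover have "countable (UNIV :: ('a \<times> 'a) set)"
      using countable_SIGMA[OF countable countable] by simp
    ultimately show ?thesis
      using sets_eq_countable[of UNIV "borel \<Otimes>\<^sub>M borel :: ('a \<times> 'a) measure"]
      by (simp add: space_pair_measure)
  qed
  define p where "p x = emeasure \<mu> {x}" for x
  define q where "q x = emeasure \<nu> {x}" for x
  have pq: "p x < \<infinity>" "q x < \<infinity>" for x
    by (simp_all add: p_def q_def \<mu>.emeasure_finite \<nu>.emeasure_finite top.not_eq_extremum[symmetric])
  define m where "m x = min (p x) (q x)" for x
  define a where "a x = p x - q x" for x
  define b where "b x = q x - p x" for x
  have ma: "m x + a x = p x" and mb: "m x + b x = q x" for x
    using pq[of x] by (auto simp: m_def a_def b_def min_def diff_eq_0_iff_ennreal add_diff_self_ennreal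
        add_diff_eq_iff_ennreal less_top not_le less_imp_le)
  have sum_p: "emeasure \<mu> B = (\<integral>\<^sup>+x. p x * indicator B x \<partial>count_space UNIV)" for B
    unfolding p_def using sets countable
    by (subst emeasure_countable_singleton)
      (auto simp: nn_integral_count_space_indicator intro: countable_subset)
  have sum_q: "emeasure \<nu> B = (\<integral>\<^sup>+x. q x * indicator B x \<partial>count_space UNIV)" for B
    unfolding q_def using sets countable
    by (subst emeasure_countable_singleton)
      (auto simp: nn_integral_count_space_indicator intro: countable_subset)
  define \<delta> where "\<delta> = (\<integral>\<^sup>+x. a x \<partial>count_space UNIV)"
  have total_a: "(\<integral>\<^sup>+x. m x \<partial>count_space UNIV) + \<delta> = 1"
    using sum_p[of UNIV] \<mu>.emeasure_space_1
    by (simp add: \<delta>_def nn_integral_add[symmetric] ma sp)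
  have total_b: "(\<integral>\<^sup>+x. m x \<partial>count_space UNIV) + (\<integral>\<^sup>+x. b x \<partial>count_space UNIV) = 1"
    using sum_q[of UNIV] \<nu>.emeasure_space_1
    by (simp add: nn_integral_add[symmetric] mb sp)
  \<comment> \<open>Both excesses complement the same common mass to 1, and this mass is finite, so
    it cancels.\<close>
  have sum_b: "(\<integral>\<^sup>+x. b x \<partial>count_space UNIV) = \<delta>"
    using total_a total_b
    by (metis ennreal_add_left_cancel ennreal_add_eq_top ennreal_one_neq_top infinity_ennreal_def)
  have \<delta>_fin: "\<delta> < \<infinity>"
    using total_a by (metis ennreal_add_eq_top ennreal_one_neq_top infinity_ennreal_def top.not_eq_extremum)
  have \<delta>_le: "\<delta> \<le> ennreal e"
  proof -
    \<comment> \<open>On \<open>B\<close>, where \<open>\<mu>\<close> has the larger point masses,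
      the whole excess \<open>a\<close> is concentrated, so \<open>\<delta>\<close> is the
      difference of the measures of \<open>B\<close>. The identity is proved in additive form
      because subtraction in \<open>ennreal\<close> is truncated.\<close>
    define B where "B = {x. q x < p x}"
    have "\<delta> = (\<integral>\<^sup>+x. a x * indicator B x \<partial>count_space UNIV)"
      unfolding \<delta>_def using pq
      by (intro nn_integral_cong) (auto simp: B_def a_def indicator_def diff_eq_0_iff_ennreal not_less)
    then have "\<delta> + emeasure \<nu> B = (\<integral>\<^sup>+x. a x * indicator B x + q x * indicator B x \<partial>count_space UNIV)"
      by (simp add: sum_q nn_integral_add[symmetric])
    also have "\<dots> = (\<integral>\<^sup>+x. p x * indicator B x \<partial>count_space UNIV)"
      using pq by (intro nn_integral_cong)
        (auto simp: B_def a_def indicator_def diff_add_cancel_ennreal)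
    also have "\<dots> = emeasure \<mu> B" by (simp add: sum_p)
    finally have "\<delta> + emeasure \<nu> B = emeasure \<mu> B" .
    moreover have "\<bar>measure \<mu> B - measure \<nu> B\<bar> \<le> e"
      using tv borel unfolding tv_dist_le_iff by simp
    ultimately show ?thesis using \<delta>_fin
      by (cases \<delta>) (auto simp: \<mu>.emeasure_eq_measure \<nu>.emeasure_eq_measure ennreal_plus[symmetric]
          simp del: ennreal_plus intro!: ennreal_leI)
  qed
  have a_le: "a x \<le> \<delta>" and b_le: "b x \<le> \<delta>" for x
    using nn_integral_ge_point[of x UNIV a] nn_integral_ge_point[of x UNIV b] sum_b
    by (simp_all add: \<delta>_def)
  \<comment> \<open>\<open>\<delta> / \<delta>\<close> is 1 unless \<open>\<delta> = 0\<close>; in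
    that case \<open>a\<close> and \<open>b\<close> vanish, so \<open>g\<close> below needs no
    separate definition for \<open>\<mu> = \<nu>\<close>.\<close>
  have a_cancel: "a x * (\<delta> / \<delta>) = a x" and b_cancel: "b x * (\<delta> / \<delta>) = b x" for x
    using a_le[of x] b_le[of x] \<delta>_fin by (cases "\<delta> = 0"; simp)+
  define g where "g z = m (fst z) * indicator {fst z} (snd z) + a (fst z) * (b (snd z) / \<delta>)" for z
  have g_fst: "(\<integral>\<^sup>+y. g (x, y) \<partial>count_space UNIV) = p x" for x
    by (simp add: g_def nn_integral_add nn_integral_cmult nn_integral_divide sum_b a_cancel ma)
  have g_snd: "(\<integral>\<^sup>+x. g (x, y) \<partial>count_space UNIV) = q y" for y
  proof -
    \<comment> \<open>The division by \<open>\<delta>\<close> is moved from \<open>b\<close> to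
      \<open>a\<close>, which makes the sum over \<open>x\<close> symmetric to the one in
      \<open>g_fst\<close>.\<close>
    have "(\<integral>\<^sup>+x. g (x, y) \<partial>count_space UNIV)
        = (\<integral>\<^sup>+x. m y * indicator {y} x + b y * (a x / \<delta>) \<partial>count_space UNIV)"
      by (intro nn_integral_cong)
        (auto simp: g_def indicator_def divide_ennreal_def mult_ac)
    then show ?thesis
      by (simp add: nn_integral_add nn_integral_cmult nn_integral_divide b_cancel mb flip: \<delta>_def)
  qed
  define \<gamma> where "\<gamma> = density (count_space UNIV) g"
  have sets_\<gamma>: "sets \<gamma> = UNIV" by (simp add: \<gamma>_def)
  have sp_\<gamma>: "space \<gamma> = UNIV" by (simp add: \<gamma>_def)
  have meas: "fst \<in> \<gamma> \<rightarrow>\<^sub>M borel" "snd \<in> \<gamma> \<rightarrow>\<^sub>M borel"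
    by (simp_all add: \<gamma>_def)
  have dfst: "distr \<gamma> borel fst = \<mu>"
  proof (rule measure_eqI_countable[where A = UNIV])
    fix x
    have "emeasure (distr \<gamma> borel fst) {x} = (\<integral>\<^sup>+z. g z * indicator ({x} \<times> UNIV) z \<partial>count_space UNIV)"
      using meas by (simp add: emeasure_distr sp_\<gamma> fst_vimage_eq_Times \<gamma>_def emeasure_density)
    also have "\<dots> = (\<integral>\<^sup>+u. (\<integral>\<^sup>+v. g (u, v) \<partial>count_space UNIV) * indicator {x} u \<partial>count_space UNIV)"
      by (subst nn_integral_fst_count_space[symmetric])
        (auto intro!: nn_integral_cong simp: indicator_def)
    finally show "emeasure (distr \<gamma> borel fst) {x} = emeasure \<mu> {x}"
      by (simp add: g_fst p_def)
  qed (simp_all add: borel sets countable)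
  have dsnd: "distr \<gamma> borel snd = \<nu>"
  proof (rule measure_eqI_countable[where A = UNIV])
    fix y
    have "emeasure (distr \<gamma> borel snd) {y} = (\<integral>\<^sup>+z. g z * indicator (UNIV \<times> {y}) z \<partial>count_space UNIV)"
      using meas by (simp add: emeasure_distr sp_\<gamma> snd_vimage_eq_Times \<gamma>_def emeasure_density)
    also have "\<dots> = (\<integral>\<^sup>+v. (\<integral>\<^sup>+u. g (u, v) \<partial>count_space UNIV) * indicator {y} v \<partial>count_space UNIV)"
      by (subst nn_integral_snd_count_space[symmetric])
        (auto intro!: nn_integral_cong simp: indicator_def)
    finally show "emeasure (distr \<gamma> borel snd) {y} = emeasure \<nu> {y}"
      by (simp add: g_snd q_def)
  qed (simp_all add: borel sets countable)
  have "prob_space \<gamma>"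
    using prob_space_distrD[OF meas(1)] dfst \<mu>.prob_space_axioms by simp
  then have "\<gamma> \<in> couplings \<mu> \<nu>"
    by (simp add: couplings_def space_prob_algebra sets_\<gamma> pair dfst dsnd)
  then have "wasserstein1 \<mu> \<nu> \<le> (\<integral>\<^sup>+(x, y). ennreal (dist x y) \<partial>\<gamma>)"
    unfolding wasserstein1_def by (rule INF_lower)
  also have "\<dots> = (\<integral>\<^sup>+z. g z * ennreal (dist (fst z) (snd z)) \<partial>count_space UNIV)"
    by (simp add: \<gamma>_def nn_integral_density case_prod_unfold)
  also have "\<dots> = (\<integral>\<^sup>+u. \<integral>\<^sup>+v. g (u, v) * ennreal (dist u v) \<partial>count_space UNIV \<partial>count_space UNIV)"
    by (subst nn_integral_fst_count_space[symmetric]) simp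
  also have "\<dots> \<le> (\<integral>\<^sup>+u. \<integral>\<^sup>+v. ennreal D * (a u * (b v / \<delta>)) \<partial>count_space UNIV \<partial>count_space UNIV)"
  proof (intro nn_integral_mono)
    fix u v
    \<comment> \<open>The common mass sits on the diagonal, where the distance is 0, so only the
      product of the excesses contributes.\<close>
    have "g (u, v) * ennreal (dist u v) = (a u * (b v / \<delta>)) * ennreal (dist u v)"
      by (auto simp: g_def indicator_def)
    also have "\<dots> \<le> (a u * (b v / \<delta>)) * ennreal D"
      using diam by (intro mult_left_mono ennreal_leI) auto
    finally show "g (u, v) * ennreal (dist u v) \<le> ennreal D * (a u * (b v / \<delta>))"
      by (simp add: mult.commute)
  qed
  also have "\<dots> = ennreal D * \<delta>"
    by (simp add: nn_integral_cmult nn_integral_divide sum_b a_cancel flip: \<delta>_def)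
  also have "\<dots> \<le> ennreal D * ennreal e"
    using \<delta>_le by (intro mult_left_mono) auto
  also have "\<dots> = ennreal (D * e)"
    \<comment> \<open>The distance from a point to itself yields \<open>D \<ge> 0\<close>, the side
      condition of \<open>ennreal_mult'\<close>.\<close>
    using diam[of undefined undefined] by (simp add: ennreal_mult')
  finally show ?thesis .
qed

section \<open>Curvature bounds and the two comparisons\<close>

text \<open>This clears the denominator \<open>dist x y\<close>. An infinite Wasserstein distance
  makes both sides false. \<open>c \<ge> 0\<close> makes the diagonal pairs, of curvature 1, satisfy
  the bound and keeps \<open>ennreal\<close> from truncating \<open>c * dist x y\<close>.\<close>

lemma curvature_ge_iff:
  assumes "c \<ge> 0"
  shows "curvature P k \<ge> ereal (1 - c) \<longleftrightarrow>
    (\<forall>x y. x \<noteq> y \<longrightarrow> wasserstein1 (kernel_step P k x) (kernel_step P k y) \<le> ennreal (c * dist x y))"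
proof -
  have "ereal (1 - c) \<le> 1 - enn2ereal w / ereal d \<longleftrightarrow> w \<le> ennreal (c * d)" if "d > 0" for w d
    using that assms
    by (cases w) (auto simp: enn2ereal_ennreal one_ereal_def ennreal_le_iff field_simps top_unique)
  then have "ereal (1 - c) \<le> curvature_at P k x y \<longleftrightarrow>
    (x \<noteq> y \<longrightarrow> wasserstein1 (kernel_step P k x) (kernel_step P k y) \<le> ennreal (c * dist x y))" for x y
    using assms by (simp add: curvature_at_def one_ereal_def)
  then show ?thesis by (simp add: curvature_def le_INF_iff)
qed

theorem proposition3p3:
  fixes P :: "'a::polish_space \<Rightarrow> 'a measure" and \<pi> :: "'a measure" and d0 :: real
  assumes two_points: "\<exists>x y :: 'a. x \<noteq> y"
    and kernel: "markov_kernel P"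
    and stationary: "stationary_distribution P \<pi>"
    and finite_diam: "bounded (UNIV :: 'a set)"
    and d0_pos: "d0 > 0"
    and separated: "\<And>x y :: 'a. x \<noteq> y \<Longrightarrow> dist x y \<ge> d0"
  shows "(\<forall>\<epsilon>>0. mixing_time P \<pi> \<epsilon> \<le>
            Inf {enat k | k. 1 - curvature P k \<le> ereal (\<epsilon> * d0 / diameter (UNIV :: 'a set))})
       \<and> (\<forall>\<epsilon>>0. \<forall>k. enat k \<ge> mixing_time P \<pi> (\<epsilon> / 2) \<longrightarrow>
            curvature P k \<ge> ereal (1 - \<epsilon> * diameter (UNIV :: 'a set) / d0))"
proof -
  define D where "D = diameter (UNIV :: 'a set)"
  have diam: "dist x y \<le> D" for x y :: 'a
    unfolding D_def using finite_diam by (intro diameter_bounded_bound) auto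
  have D: "D > 0" using two_points separated diam d0_pos by (meson less_le_trans)
  have steps: "kernel_step P k x \<in> space (prob_algebra borel)" for k x
    using kernel by (rule kernel_step_in_prob_algebra)
  have "mixing_time P \<pi> \<epsilon> \<le> enat k"
    if "\<epsilon> > 0" and k: "1 - curvature P k \<le> ereal (\<epsilon> * d0 / D)" for \<epsilon> k
    unfolding mixing_time_le_iff[OF kernel]
  proof
    fix x
    have "ereal (1 - \<epsilon> * d0 / D) \<le> curvature P k"
      \<comment> \<open>The real upper bound in \<open>k\<close> excludes the value
        \<open>-\<infinity>\<close>, so the inequality can be rearranged.\<close>
      using k by (cases "curvature P k") (auto simp: one_ereal_def)
    then have W: "wasserstein1 (kernel_step P k x) (kernel_step P k y) \<le> ennreal (\<epsilon> * d0 / D * dist x y)"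
      if "x \<noteq> y" for y
      using that \<open>\<epsilon> > 0\<close> d0_pos D by (subst (asm) curvature_ge_iff) auto
    have "tv_dist (kernel_step P k x) (kernel_step P k y) \<le> ereal \<epsilon>" for y
    proof (cases "x = y")
      case True
      with \<open>\<epsilon> > 0\<close> show ?thesis by (simp add: tv_dist_le_iff)
    next
      case False
      \<comment> \<open>Replacing the distance by its maximum \<open>D\<close> cancels the
        denominator and leaves \<open>\<epsilon> * d0\<close>, which the passage to total variation
        divides by \<open>d0\<close>.\<close>
      have "\<epsilon> * d0 / D * dist x y \<le> \<epsilon> * d0 / D * D"
        using diam \<open>\<epsilon> > 0\<close> d0_pos D by (intro mult_left_mono) auto
      then have "ennreal (\<epsilon> * d0 / D * dist x y) \<le> ennreal (\<epsilon> * d0)"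
        using D by (intro ennreal_leI) simp
      with W[OF False] \<open>\<epsilon> > 0\<close> show ?thesis
        by (intro tv_dist_le_wasserstein1[OF steps steps d0_pos separated]) auto
    qed
    with kernel stationary show "tv_dist (kernel_step P k x) \<pi> \<le> ereal \<epsilon>"
      by (rule tv_dist_stationary_le)
  qed
  moreover have "curvature P k \<ge> ereal (1 - \<epsilon> * D / d0)"
    if "\<epsilon> > 0" and k: "enat k \<ge> mixing_time P \<pi> (\<epsilon> / 2)" for \<epsilon> k
  proof (subst curvature_ge_iff; (intro allI impI)?)
    show "0 \<le> \<epsilon> * D / d0" using \<open>\<epsilon> > 0\<close> d0_pos D by simp
    fix x y :: 'a assume "x \<noteq> y"
    \<comment> \<open>Two errors of \<open>\<epsilon> / 2\<close> add up in the triangle inequality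
      through \<open>\<pi>\<close>.\<close>
    have near: "\<bar>measure (kernel_step P k z) A - measure \<pi> A\<bar> \<le> \<epsilon> / 2" if "A \<in> sets borel" for z and A :: "'a set"
      using k that by (simp add: mixing_time_le_iff[OF kernel] tv_dist_le_iff)
    have "tv_dist (kernel_step P k x) (kernel_step P k y) \<le> ereal \<epsilon>"
      unfolding tv_dist_le_iff
    proof
      fix A :: "'a set" assume "A \<in> sets borel"
      from near[OF this, of x] near[OF this, of y]
      show "\<bar>measure (kernel_step P k x) A - measure (kernel_step P k y) A\<bar> \<le> \<epsilon>"
        by linarith
    qed
    then have "wasserstein1 (kernel_step P k x) (kernel_step P k y) \<le> ennreal (D * \<epsilon>)"
      by (intro wasserstein1_le_of_countable countable_separated_UNIV[OF d0_pos separated] steps diam)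
    also have "\<dots> \<le> ennreal (\<epsilon> * D / d0 * dist x y)"
    proof (rule ennreal_leI)
      \<comment> \<open>The lower bound \<open>d0\<close> on the distance of distinct points gives
        \<open>1 \<le> dist x y / d0\<close>; this is where the factor \<open>D / d0\<close>
        arises.\<close>
      have "D * \<epsilon> * d0 \<le> D * \<epsilon> * dist x y"
        using separated[OF \<open>x \<noteq> y\<close>] \<open>\<epsilon> > 0\<close> D by (intro mult_left_mono) auto
      then show "D * \<epsilon> \<le> \<epsilon> * D / d0 * dist x y" using d0_pos by (simp add: field_simps)
    qed
    finally show "wasserstein1 (kernel_step P k x) (kernel_step P k y) \<le> ennreal (\<epsilon> * D / d0 * dist x y)" .
  qed
  \<comment> \<open>The mixing time is a lower bound of the set of admissible \<open>k\<close>; for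
    an empty set the infimum is \<open>\<infinity>\<close> and this is still correct.\<close>
  ultimately show ?thesis by (auto simp: D_def intro!: Inf_greatest)
qed

end
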